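(* Let $\mathbf{F}$ be a field, $\lambda\in\mathbf{F}$, and let $(A,\ast,\alpha,P)$ be a Rota-Baxter Hom-Novikov superalgebra of weight $\lambda$ over $\mathbf{F}$, with $P$ an even linear map. Assume that $\alpha$ and $P$ commute. Define $$x\circ y:=P(x)\ast y+x\ast P(y)+\lambda\, x\ast y,\qquad \forall x,y\in A.$$ Then $(A,\circ,\alpha)$ is a Hom-Novikov superalgebra.
   Context: $\mathbf{F}$ is an arbitrary field. All graded spaces are $\mathbb{Z}_2$-graded, $A=A_{\bar 0}\oplus A_{\bar 1}$, $|x|$ is the degree of a homogeneous element $x$, and identities involving signs are required for all homogeneous elements. A linear map $A\to A$ is even if it preserves degree; a bilinear map is even if degrees add. A Hom-Novikov superalgebra is a triple $(A,\cdot,\alpha)$, where $A$ is a $\mathbb{Z}_2$-graded vector space, $\cdot$ is an even bilinear product and $\alpha:A\to A$ is an even linear map, such that for all homogeneous $x,y,z$: (1) $\alpha(x\cdot y)=\alpha(x)\cdot\alpha(y)$; (2) $(x\cdot y)\cdot\alpha(z)-\alpha(x)\cdot(y\cdot z)=(-1)^{|x||y|}\big((y\cdot x)\cdot\alpha(z)-\alpha(y)\cdot(x\cdot z)\big)$; (3) $(x\cdot y)\cdot\alpha(z)=(-1)^{|y||z|}(x\cdot z)\cdot\alpha(y)$. A Rota-Baxter Hom-Novikov superalgebra of weight $\lambda$ is a quadruple $(A,\ast,\alpha,P)$, where $(A,\ast,\alpha)$ is a Hom-Novikov superalgebra and $P:A\to A$ is a linear map (a Rota-Baxter operator of weight $\lambda$)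 satisfying $P(x)\ast P(y)=P\big(P(x)\ast y+x\ast P(y)+\lambda\, x\ast y\big)$ for all $x,y\in A$. *)

theory Defs
  imports Complex_Main "HOL-Library.Z2"
begin

text \<open>
  Degrees are elements of the two-element field \<open>bit\<close>; a \<open>\<int>\<^sub>2\<close>-grading of a vector space is a
  family \<open>V :: bit \<Rightarrow> 'v set\<close> whose members \<open>V 0\<close> and \<open>V 1\<close> are the even and the odd part.
  The zero vector lies in both parts; every identity below is trivial when one of its
  arguments is zero, so this ambiguity of the degree of zero is harmless.
\<close>

locale super_vector_space = vector_space scale
  for scale :: "'f::field \<Rightarrow> 'v::ab_group_add \<Rightarrow> 'v"  (infixr \<open>*s\<close> 75)
  and V :: "bit \<Rightarrow> 'v set" +
  assumes subspace_component: "subspace (V i)"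
    and components_disjoint: "V 0 \<inter> V 1 = {0}"
    and components_span: "\<exists>x\<^sub>0\<in>V 0. \<exists>x\<^sub>1\<in>V 1. x = x\<^sub>0 + x\<^sub>1"

definition even_map :: "(bit \<Rightarrow> 'v set) \<Rightarrow> ('v \<Rightarrow> 'v) \<Rightarrow> bool"
  where "even_map V f \<longleftrightarrow> (\<forall>i. \<forall>x\<in>V i. f x \<in> V i)"

definition even_product :: "(bit \<Rightarrow> 'v set) \<Rightarrow> ('v \<Rightarrow> 'v \<Rightarrow> 'v) \<Rightarrow> bool"
  where "even_product V m \<longleftrightarrow> (\<forall>i j. \<forall>x\<in>V i. \<forall>y\<in>V j. m x y \<in> V (i + j))"

definition bilinear_product ::
    "('f::field \<Rightarrow> 'v::ab_group_add \<Rightarrow> 'v) \<Rightarrow> ('v \<Rightarrow> 'v \<Rightarrow> 'v) \<Rightarrow> bool"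
  where "bilinear_product scale m \<longleftrightarrow>
    (\<forall>x. Vector_Spaces.linear scale scale (\<lambda>y. m x y)) \<and>
    (\<forall>y. Vector_Spaces.linear scale scale (\<lambda>x. m x y))"

definition koszul_sign :: "bit \<Rightarrow> bit \<Rightarrow> 'f::field"
  where "koszul_sign i j = (- 1) ^ (of_bit i * of_bit j)"

locale hom_novikov_superalgebra = super_vector_space scale V
  for scale :: "'f::field \<Rightarrow> 'v::ab_group_add \<Rightarrow> 'v"  (infixr \<open>*s\<close> 75)
  and V :: "bit \<Rightarrow> 'v set"
  and mult :: "'v \<Rightarrow> 'v \<Rightarrow> 'v"  (infixl \<open>\<cdot>\<close> 77)
  and \<alpha> :: "'v \<Rightarrow> 'v" +
  assumes bilinear_mult: "bilinear_product scale mult"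
    and even_mult: "even_product V mult"
    and linear_twist: "Vector_Spaces.linear scale scale \<alpha>"
    and even_twist: "even_map V \<alpha>"
    and twist_mult: "\<lbrakk>x \<in> V i; y \<in> V j\<rbrakk> \<Longrightarrow> \<alpha> (x \<cdot> y) = \<alpha> x \<cdot> \<alpha> y"
    and hom_left_symmetric: "\<lbrakk>x \<in> V i; y \<in> V j; z \<in> V k\<rbrakk> \<Longrightarrow>
      (x \<cdot> y) \<cdot> \<alpha> z - \<alpha> x \<cdot> (y \<cdot> z)
        = koszul_sign i j *s ((y \<cdot> x) \<cdot> \<alpha> z - \<alpha> y \<cdot> (x \<cdot> z))"
    and hom_right_commutative: "\<lbrakk>x \<in> V i; y \<in> V j; z \<in> V k\<rbrakk> \<Longrightarrow>
      (x \<cdot> y) \<cdot> \<alpha> z = koszul_sign j k *s ((x \<cdot> z) \<cdot> \<alpha> y)"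

text \<open>A Rota-Baxter operator is linear; that it preserves the degree is not part of the definition.\<close>

locale rota_baxter_hom_novikov_superalgebra = hom_novikov_superalgebra scale V mult \<alpha>
  for scale :: "'f::field \<Rightarrow> 'v::ab_group_add \<Rightarrow> 'v"  (infixr \<open>*s\<close> 75)
  and V :: "bit \<Rightarrow> 'v set"
  and mult :: "'v \<Rightarrow> 'v \<Rightarrow> 'v"  (infixl \<open>\<cdot>\<close> 77)
  and \<alpha> :: "'v \<Rightarrow> 'v"
  and P :: "'v \<Rightarrow> 'v"
  and wt :: 'f +
  assumes linear_rota_baxter: "Vector_Spaces.linear scale scale P"
    and rota_baxter: "P x \<cdot> P y = P (P x \<cdot> y + x \<cdot> P y + wt *s (x \<cdot> y))"

end

theory Submission
  imports Defs
begin

text \<open>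
  Write \<open>x \<circ> y = P x \<cdot> y + x \<cdot> P y + wt *s (x \<cdot> y)\<close>, so that the Rota--Baxter identity says
  \<open>P (x \<circ> y) = P x \<cdot> P y\<close>. Together with \<open>\<alpha> \<circ> P = P \<circ> \<alpha>\<close> this turns each of the triple products
  \<open>(x \<circ> y) \<circ> \<alpha> z\<close> and \<open>\<alpha> x \<circ> (y \<circ> z)\<close> into the same combination of the corresponding original
  triple products, in which \<open>P\<close> is inserted in two, one or none of the three arguments with
  coefficients \<open>1\<close>, \<open>wt\<close> and \<open>wt\<^sup>2\<close>. The combination is symmetric in the three arguments and \<open>P\<close>
  preserves degrees, hence identities that permute the arguments up to Koszul signs carry over.
\<close>

context rota_baxter_hom_novikov_superalgebra
begin

definition induced_mult :: "'v \<Rightarrow> 'v \<Rightarrow> 'v"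
  where "induced_mult x y = P x \<cdot> y + x \<cdot> P y + wt *s (x \<cdot> y)"

text \<open>The ternary map \<open>T\<close> is a parameter so that one combination serves both
  bracketings and also their difference, the Hom-associator.\<close>

definition insert_rota_baxter :: "('v \<Rightarrow> 'v \<Rightarrow> 'v \<Rightarrow> 'v) \<Rightarrow> 'v \<Rightarrow> 'v \<Rightarrow> 'v \<Rightarrow> 'v"
  where "insert_rota_baxter T x y z =
    T (P x) (P y) z + T (P x) y (P z) + T x (P y) (P z)
    + wt *s (T (P x) y z + T x (P y) z + T x y (P z)) + wt *s wt *s T x y z"

lemma linear_mult_right: "Vector_Spaces.linear scale scale (\<lambda>y. x \<cdot> y)"
  and linear_mult_left: "Vector_Spaces.linear scale scale (\<lambda>x. x \<cdot> y)"
  using bilinear_mult by (auto simp: bilinear_product_def)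

lemmas mult_linear_simps =
  module_hom.add[OF Vector_Spaces.linear.axioms(3)[OF linear_mult_right]]
  module_hom.add[OF Vector_Spaces.linear.axioms(3)[OF linear_mult_left]]
  module_hom.scale[OF Vector_Spaces.linear.axioms(3)[OF linear_mult_right]]
  module_hom.scale[OF Vector_Spaces.linear.axioms(3)[OF linear_mult_left]]

lemmas twist_add = module_hom.add[OF Vector_Spaces.linear.axioms(3)[OF linear_twist]]
lemmas twist_scale = module_hom.scale[OF Vector_Spaces.linear.axioms(3)[OF linear_twist]]
lemmas rota_baxter_add = module_hom.add[OF Vector_Spaces.linear.axioms(3)[OF linear_rota_baxter]]
lemmas rota_baxter_scale = module_hom.scale[OF Vector_Spaces.linear.axioms(3)[OF linear_rota_baxter]]

lemma rota_baxter_induced_mult: "P (induced_mult x y) = P x \<cdot> P y"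
  by (simp add: induced_mult_def rota_baxter)

lemma bilinear_induced_mult: "bilinear_product scale induced_mult"
  unfolding bilinear_product_def induced_mult_def Vector_Spaces.linear_iff
  by (auto intro!: vector_space_axioms
      simp: rota_baxter_add rota_baxter_scale mult_linear_simps scale_right_distrib scale_left_commute
        algebra_simps)

lemma even_induced_mult:
  assumes "even_map V P"
  shows "even_product V induced_mult"
  using assms even_mult unfolding even_product_def even_map_def induced_mult_def
  by (blast intro: subspace_add subspace_scale subspace_component)

lemma twist_induced_mult:
  assumes "even_map V P" "\<alpha> \<circ> P = P \<circ> \<alpha>" "x \<in> V i" "y \<in> V j"
  shows "\<alpha> (induced_mult x y) = induced_mult (\<alpha> x) (\<alpha> y)"
proof -
  \<comment> \<open>Multiplicativity of \<open>\<alpha>\<close> is assumed only for homogeneous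
    arguments, so the degrees of \<open>P x\<close> and \<open>P y\<close> must be known
    first.\<close>
  have P_in: "P x \<in> V i" "P y \<in> V j"
    using assms by (auto simp: even_map_def)
  have comm: "\<alpha> (P u) = P (\<alpha> u)" for u
    using assms(2) by (metis comp_apply)
  show ?thesis
    using twist_mult[OF assms(3,4)] twist_mult[OF P_in(1) assms(4)] twist_mult[OF assms(3) P_in(2)]
    by (simp add: induced_mult_def twist_add twist_scale comm)
qed

text \<open>The factor \<open>P (induced_mult x y)\<close> collapses to
  \<open>P x \<cdot> P y\<close>, which gives one term; bilinearity expands each of the other two
  summands into three, so all seven terms appear.\<close>

lemma induced_left_triple:
  assumes "\<alpha> \<circ> P = P \<circ> \<alpha>"
  shows "induced_mult (induced_mult x y) (\<alpha> z) =
    insert_rota_baxter (\<lambda>x y z. (x \<cdot> y) \<cdot> \<alpha> z) x y z"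
proof -
  have comm: "P (\<alpha> u) = \<alpha> (P u)" for u
    using assms by (metis comp_apply)
  have "induced_mult (induced_mult x y) (\<alpha> z) =
      (P x \<cdot> P y) \<cdot> \<alpha> z + induced_mult x y \<cdot> \<alpha> (P z) + wt *s (induced_mult x y \<cdot> \<alpha> z)"
    \<comment> \<open>Only the outer product is unfolded, so that \<open>P\<close> still meets an
      intact inner \<open>induced_mult\<close>.\<close>
    by (subst induced_mult_def) (simp only: rota_baxter_induced_mult comm)
  then show ?thesis
    by (simp add: induced_mult_def insert_rota_baxter_def mult_linear_simps scale_right_distrib
        ac_simps del: scale_scale)
qed

lemma induced_right_triple:
  assumes "\<alpha> \<circ> P = P \<circ> \<alpha>"
  shows "induced_mult (\<alpha> x) (induced_mult y z) =
    insert_rota_baxter (\<lambda>x y z. \<alpha> x \<cdot> (y \<cdot> z)) x y z"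
proof -
  have comm: "P (\<alpha> u) = \<alpha> (P u)" for u
    using assms by (metis comp_apply)
  have "induced_mult (\<alpha> x) (induced_mult y z) =
      \<alpha> (P x) \<cdot> induced_mult y z + \<alpha> x \<cdot> (P y \<cdot> P z) + wt *s (\<alpha> x \<cdot> induced_mult y z)"
    by (subst induced_mult_def) (simp only: rota_baxter_induced_mult comm)
  then show ?thesis
    by (simp add: induced_mult_def insert_rota_baxter_def mult_linear_simps scale_right_distrib
        ac_simps del: scale_scale)
qed

lemma insert_rota_baxter_diff:
  "insert_rota_baxter T x y z - insert_rota_baxter U x y z =
    insert_rota_baxter (\<lambda>x y z. T x y z - U x y z) x y z"
  by (simp add: insert_rota_baxter_def scale_right_distrib scale_right_diff_distrib algebra_simps)

lemma insert_rota_baxter_scale: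
  "insert_rota_baxter (\<lambda>x y z. c *s T x y z) x y z = c *s insert_rota_baxter T x y z"
  by (simp add: insert_rota_baxter_def scale_right_distrib mult.commute mult.left_commute)

text \<open>Since \<open>P\<close> is even, all seven argument triples keep the degrees
  \<open>i\<close>, \<open>j\<close>, \<open>k\<close>; an identity whose sign depends only on these
  degrees thus applies to every term.\<close>

lemma insert_rota_baxter_cong:
  assumes "even_map V P" "x \<in> V i" "y \<in> V j" "z \<in> V k"
    and "\<And>x y z. \<lbrakk>x \<in> V i; y \<in> V j; z \<in> V k\<rbrakk> \<Longrightarrow> T x y z = U x y z"
  shows "insert_rota_baxter T x y z = insert_rota_baxter U x y z"
  using assms unfolding insert_rota_baxter_def even_map_def by simp

text \<open>Exchanging two arguments merely permutes the summands that carry equally many copies of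
  \<open>P\<close>, and these share their coefficient.\<close>

lemma insert_rota_baxter_swap_left:
  "insert_rota_baxter (\<lambda>x y z. T y x z) x y z = insert_rota_baxter T y x z"
  by (simp add: insert_rota_baxter_def ac_simps)

lemma insert_rota_baxter_swap_right:
  "insert_rota_baxter (\<lambda>x y z. T x z y) x y z = insert_rota_baxter T x z y"
  by (simp add: insert_rota_baxter_def ac_simps)

lemma induced_hom_left_symmetric:
  assumes "even_map V P" "\<alpha> \<circ> P = P \<circ> \<alpha>" "x \<in> V i" "y \<in> V j" "z \<in> V k"
  shows "induced_mult (induced_mult x y) (\<alpha> z) - induced_mult (\<alpha> x) (induced_mult y z) =
    koszul_sign i j *s
      (induced_mult (induced_mult y x) (\<alpha> z) - induced_mult (\<alpha> y) (induced_mult x z))"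
proof -
  \<comment> \<open>This is the Hom-associator of the original product.\<close>
  let ?as = "\<lambda>x y z. (x \<cdot> y) \<cdot> \<alpha> z - \<alpha> x \<cdot> (y \<cdot> z)"
  have "insert_rota_baxter ?as x y z =
      insert_rota_baxter (\<lambda>x y z. koszul_sign i j *s ?as y x z) x y z"
    by (rule insert_rota_baxter_cong[OF assms(1,3-5)]) (rule hom_left_symmetric)
  also have "\<dots> = koszul_sign i j *s insert_rota_baxter ?as y x z"
    \<comment> \<open>The swap rule is instantiated because its left-hand side with schematic
      \<open>T\<close> matches every ternary map.\<close>
    by (simp only: insert_rota_baxter_scale insert_rota_baxter_swap_left[of ?as])
  finally show ?thesis
    by (simp only: induced_left_triple[OF assms(2)] induced_right_triple[OF assms(2)]
        insert_rota_baxter_diff)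
qed

lemma induced_hom_right_commutative:
  assumes "even_map V P" "\<alpha> \<circ> P = P \<circ> \<alpha>" "x \<in> V i" "y \<in> V j" "z \<in> V k"
  shows "induced_mult (induced_mult x y) (\<alpha> z) =
    koszul_sign j k *s induced_mult (induced_mult x z) (\<alpha> y)"
proof -
  let ?t = "\<lambda>x y z. (x \<cdot> y) \<cdot> \<alpha> z"
  have "insert_rota_baxter ?t x y z =
      insert_rota_baxter (\<lambda>x y z. koszul_sign j k *s ?t x z y) x y z"
    by (rule insert_rota_baxter_cong[OF assms(1,3-5)]) (rule hom_right_commutative)
  also have "\<dots> = koszul_sign j k *s insert_rota_baxter ?t x z y"
    by (simp only: insert_rota_baxter_scale insert_rota_baxter_swap_right[of ?t])
  finally show ?thesis
    by (simp only: induced_left_triple[OF assms(2)])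
qed

lemma hom_novikov_superalgebra_induced_mult:
  assumes "even_map V P" "\<alpha> \<circ> P = P \<circ> \<alpha>"
  shows "hom_novikov_superalgebra scale V induced_mult \<alpha>"
  using bilinear_induced_mult even_induced_mult[OF assms(1)] linear_twist even_twist
    twist_induced_mult[OF assms] induced_hom_left_symmetric[OF assms]
    induced_hom_right_commutative[OF assms]
  by (intro hom_novikov_superalgebra.intro super_vector_space_axioms
      hom_novikov_superalgebra_axioms.intro)

end

theorem theorem2p12:
  fixes scale :: "'f::field \<Rightarrow> 'v::ab_group_add \<Rightarrow> 'v"
    and V :: "bit \<Rightarrow> 'v set"
    and mult :: "'v \<Rightarrow> 'v \<Rightarrow> 'v"
    and \<alpha> P :: "'v \<Rightarrow> 'v"
    and wt :: 'f
  assumes "rota_baxter_hom_novikov_superalgebra scale V mult \<alpha> P wt"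
    and "even_map V P"
    and "\<alpha> \<circ> P = P \<circ> \<alpha>"
  shows "hom_novikov_superalgebra scale V
    (\<lambda>x y. mult (P x) y + mult x (P y) + scale wt (mult x y)) \<alpha>"
proof -
  interpret rota_baxter_hom_novikov_superalgebra scale V mult \<alpha> P wt
    by (rule assms(1))
  show ?thesis
    using hom_novikov_superalgebra_induced_mult[OF assms(2,3)]
    by (simp only: induced_mult_def[abs_def])
qed

end
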